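(* Let $k\ge 1$ be an integer and let $p^{(1)},\dots,p^{(k)}$ be $k$ everywhere positive probability density functions on $\mathcal{X}$ with respect to the reference measure $\mathrm{d}\mathbf{x}$. Then for all $r\in\mathbb{R}\cup\{-\infty,+\infty\}$, $$\int_{\mathcal{X}} M_{k,r}(\mathbf{x})\,\mathrm{d}\mathbf{x} < \infty,$$ where $M_{k,r}(\mathbf{x})$ is the generalized mean of order $r$ of $p^{(1)}(\mathbf{x}),\dots,p^{(k)}(\mathbf{x})$.
   Context: $\mathcal{X}$ is a data space (a measurable space) equipped with a reference measure $\mathrm{d}\mathbf{x}$. A probability density is a measurable function $p:\mathcal{X}\to\mathbb{R}_{\ge 0}$ with $\int_{\mathcal{X}} p(\mathbf{x})\,\mathrm{d}\mathbf{x}=1$. For positive reals $a_1,\dots,a_k$, the generalized (power) mean of order $r$ is $M_r(a_1,\dots,a_k)=\left(\frac1k\sum_{i=1}^k a_i^r\right)^{1/r}$ for $r\in\mathbb{R}\setminus\{0\}$, $M_0(a_1,\dots,a_k)=\left(\prod_{i=1}^k a_i\right)^{1/k}$, $M_{-\infty}(a_1,\dots,a_k)=\min_i a_i$, and $M_{+\infty}(a_1,\dots,a_k)=\max_i a_i$. For densities $p^{(1)},\dots,p^{(k)}$ define pointwise $M_{k,r}(\mathbf{x})=M_r\big(p^{(1)}(\mathbf{x}),\dots,p^{(k)}(\mathbf{x})\big)$. *)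

theory Defs
  imports "HOL-Analysis.Analysis"
begin

definition probability_density :: "'a measure \<Rightarrow> ('a \<Rightarrow> real) \<Rightarrow> bool" where
  "probability_density M p \<longleftrightarrow>
     p \<in> borel_measurable M \<and> (\<forall>x\<in>space M. 0 \<le> p x) \<and> (\<integral>\<^sup>+x. ennreal (p x) \<partial>M) = 1"

(* The mean of a 1, ..., a k; only meaningful for k \<ge> 1 and positive entries
   (for which powr is the usual real power). *)
definition power_mean :: "ereal \<Rightarrow> nat \<Rightarrow> (nat \<Rightarrow> real) \<Rightarrow> real" where
  "power_mean r k a =
     (case r of
        ereal s \<Rightarrow>
          (if s = 0 then (\<Prod>i=1..k. a i) powr (1 / real k)
           else (1 / real k * (\<Sum>i=1..k. a i powr s)) powr (1 / s))
      | PInfty \<Rightarrow> Max (a ` {1..k})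
      | MInfty \<Rightarrow> Min (a ` {1..k}))"

end

(* Every power mean of positive numbers is at most their maximum, hence at most their sum,
   and the sum of the k densities has integral k. *)
theory Submission
  imports Defs
begin

text \<open>A power mean is monotone in its entries and fixes constant tuples, so it never exceeds
  an upper bound \<open>m\<close> of the entries (\<open>power_mean_le_bound\<close>). Taking the
  pointwise sum of the densities as \<open>m\<close> gives an integrable majorant that does not
  depend on \<open>r\<close>: its integral is \<open>k\<close>.\<close>

lemma power_mean_le_bound:
  fixes a :: "nat \<Rightarrow> real"
  assumes k: "k \<ge> 1" and pos: "\<And>i. i \<in> {1..k} \<Longrightarrow> 0 < a i"
    and le: "\<And>i. i \<in> {1..k} \<Longrightarrow> a i \<le> m"
  shows "power_mean r k a \<le> m"
proof -
  have ne: "{1..k} \<noteq> {}" and one: "1 \<in> {1..k}" using k by auto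
  \<comment> \<open>Positivity lets the exponents \<open>s\<close> and \<open>1 / s\<close> cancel
    on \<open>m\<close> below.\<close>
  have m: "m > 0" using pos[OF one] le[OF one] by linarith
  show ?thesis
  proof (cases r)
    case (real s)
    consider "s = 0" | "s > 0" | "s < 0" by linarith
    then show ?thesis
    proof cases
      case 1
      have "(\<Prod>i=1..k. a i) \<le> (\<Prod>i=1..k. m)"
        using pos le by (intro prod_mono) (auto intro: less_imp_le)
      also have "\<dots> = m powr real k" using m by (simp add: powr_realpow)
      finally have "(\<Prod>i=1..k. a i) powr (1 / real k) \<le> (m powr real k) powr (1 / real k)"
        using pos by (intro powr_mono2 prod_nonneg) (auto intro: less_imp_le)
      also have "\<dots> = m" using m k by (simp add: powr_powr)
      finally show ?thesis using real 1 by (simp add: power_mean_def)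
    next
      case 2
      have "(\<Sum>i=1..k. a i powr s) \<le> (\<Sum>i=1..k. m powr s)"
        using pos le 2 by (intro sum_mono powr_mono2) (auto intro: less_imp_le)
      then have "1 / real k * (\<Sum>i=1..k. a i powr s) \<le> m powr s"
        using k by (simp add: field_simps)
      then have "(1 / real k * (\<Sum>i=1..k. a i powr s)) powr (1 / s) \<le> (m powr s) powr (1 / s)"
        using 2 by (intro powr_mono2) (auto intro!: sum_nonneg divide_nonneg_nonneg)
      also have "\<dots> = m" using m 2 by (simp add: powr_powr)
      finally show ?thesis using real 2 by (simp add: power_mean_def)
    next
      case 3
      \<comment> \<open>For negative \<open>s\<close> the map t -> t powr \<open>s\<close> is
        decreasing, which reverses the inequality; the outer exponent \<open>1 / s\<close> is
        negative too and reverses it back.\<close>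
      have "(\<Sum>i=1..k. m powr s) \<le> (\<Sum>i=1..k. a i powr s)"
        using pos le 3 by (intro sum_mono powr_mono2') auto
      then have "m powr s \<le> 1 / real k * (\<Sum>i=1..k. a i powr s)"
        using k by (simp add: field_simps)
      then have "(1 / real k * (\<Sum>i=1..k. a i powr s)) powr (1 / s) \<le> (m powr s) powr (1 / s)"
        using 3 m by (intro powr_mono2') auto
      also have "\<dots> = m" using m 3 by (simp add: powr_powr)
      finally show ?thesis using real 3 by (simp add: power_mean_def)
    qed
  next
    case PInf
    then show ?thesis using ne le by (simp add: power_mean_def)
  next
    case MInf
    have "Min (a ` {1..k}) \<le> a 1" using one by (intro Min_le) auto
    then show ?thesis using MInf le[OF one] by (simp add: power_mean_def)
  qed
qed

text \<open>For each kind of order the mean is built from finite sums, products, powers, or a finite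
  \<open>Max\<close> or \<open>Min\<close>, all of which preserve measurability. This matters
  because the nonnegative integral of a non-measurable function is only a lower integral, whose
  finiteness would say less.\<close>

lemma borel_measurable_power_mean:
  assumes [measurable]: "\<And>i. i \<in> {1..k} \<Longrightarrow> p i \<in> borel_measurable M"
  shows "(\<lambda>x. power_mean r k (\<lambda>i. p i x)) \<in> borel_measurable M"
  by (cases r) (simp_all add: power_mean_def del: One_nat_def)

theorem proposition3p1:
  fixes M :: "'a measure" and k :: nat and p :: "nat \<Rightarrow> 'a \<Rightarrow> real" and r :: ereal
  assumes "k \<ge> 1"
    and "\<And>i. i \<in> {1..k} \<Longrightarrow> probability_density M (p i)"
    and "\<And>i x. i \<in> {1..k} \<Longrightarrow> x \<in> space M \<Longrightarrow> p i x > 0"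
  shows "(\<lambda>x. power_mean r k (\<lambda>i. p i x)) \<in> borel_measurable M \<and>
         (\<integral>\<^sup>+x. ennreal (power_mean r k (\<lambda>i. p i x)) \<partial>M) < \<infinity>"
proof
  have meas [measurable]: "p i \<in> borel_measurable M" if "i \<in> {1..k}" for i
    using assms(2)[OF that] by (simp add: probability_density_def)
  show "(\<lambda>x. power_mean r k (\<lambda>i. p i x)) \<in> borel_measurable M"
    using meas by (rule borel_measurable_power_mean)
  have "(\<integral>\<^sup>+x. ennreal (power_mean r k (\<lambda>i. p i x)) \<partial>M) \<le> (\<integral>\<^sup>+x. (\<Sum>i=1..k. ennreal (p i x)) \<partial>M)"
  proof (rule nn_integral_mono)
    fix x assume x: "x \<in> space M"
    \<comment> \<open>The sum bounds each single density value because the other terms are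
      nonnegative. Unlike the maximum, it can be integrated term by term.\<close>
    have "power_mean r k (\<lambda>i. p i x) \<le> (\<Sum>i=1..k. p i x)"
      using assms(1,3) x
      by (intro power_mean_le_bound member_le_sum) (auto intro: less_imp_le)
    then show "ennreal (power_mean r k (\<lambda>i. p i x)) \<le> (\<Sum>i=1..k. ennreal (p i x))"
      using assms(3) x by (subst sum_ennreal) (auto intro: less_imp_le ennreal_leI)
  qed
  also have "\<dots> = (\<Sum>i=1..k. \<integral>\<^sup>+x. ennreal (p i x) \<partial>M)"
    by (intro nn_integral_sum) measurable
  also have "\<dots> = of_nat k"
    using assms(2) by (simp add: probability_density_def)
  also have "\<dots> < \<infinity>" by (simp add: of_nat_less_top)
  finally show "(\<integral>\<^sup>+x. ennreal (power_mean r k (\<lambda>i. p i x)) \<partial>M) < \<infinity>" .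
qed

end
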